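(* Let $X$ be an infinite Hausdorff topological space and let $f : X \to X$ be a continuous map that is topologically transitive and whose set $P$ of periodic points is dense in $X$. Then $(X,f)$ has a dense set of large periodic points (DLP); that is, for every positive integer $n$, the set $P \setminus P_n$ of periodic points of period strictly greater than $n$ is dense in $X$.
   Context: A point $x \in X$ is periodic if $f^{n}(x)=x$ for some positive integer $n$, where $f^n$ is the $n$-fold composition of $f$; the smallest such $n$ is the period of $x$. $P$ denotes the set of all periodic points of $f$, and for a positive integer $n$, $P_n$ denotes the set of all periodic points of period $\le n$. The map $f$ is topologically transitive if for any two non-empty open sets $V, W \subseteq X$ there is a positive integer $n$ with $f^{n}(V) \cap W \neq \emptyset$. The system $(X,f)$ has DLP if $P \setminus P_n$ is dense in $X$ for every positive integer $n$. *)

theory Defs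
  imports "HOL-Analysis.Analysis"
begin

text \<open>
  A topological space is an arbitrary \<open>'a topology\<close>, so its points are the members of
  \<open>topspace X\<close>, and a set \<open>S \<subseteq> topspace X\<close> is dense iff \<open>X closure_of S = topspace X\<close>.
  A self-map is a total function \<open>f :: 'a \<Rightarrow> 'a\<close>; only its values on \<open>topspace X\<close> matter.
\<close>

definition periodic_points :: "'a topology \<Rightarrow> ('a \<Rightarrow> 'a) \<Rightarrow> 'a set" where
  "periodic_points X f = {x \<in> topspace X. \<exists>n>0. (f ^^ n) x = x}"

text \<open>Meaningful for periodic points only; elsewhere the value is unspecified.\<close>

definition period :: "('a \<Rightarrow> 'a) \<Rightarrow> 'a \<Rightarrow> nat" where
  "period f x = (LEAST n. n > 0 \<and> (f ^^ n) x = x)"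

definition periodic_points_upto :: "'a topology \<Rightarrow> ('a \<Rightarrow> 'a) \<Rightarrow> nat \<Rightarrow> 'a set" where
  "periodic_points_upto X f n = {x \<in> periodic_points X f. period f x \<le> n}"

definition topologically_transitive :: "'a topology \<Rightarrow> ('a \<Rightarrow> 'a) \<Rightarrow> bool" where
  "topologically_transitive X f \<longleftrightarrow>
     (\<forall>V W. openin X V \<and> V \<noteq> {} \<and> openin X W \<and> W \<noteq> {} \<longrightarrow>
        (\<exists>n>0. (f ^^ n) ` V \<inter> W \<noteq> {}))"

definition DLP :: "'a topology \<Rightarrow> ('a \<Rightarrow> 'a) \<Rightarrow> bool" where
  "DLP X f \<longleftrightarrow>
     (\<forall>n>0. X closure_of (periodic_points X f - periodic_points_upto X f n) = topspace X)"

end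

theory Submission
  imports Defs
begin

text \<open>
  If a nonempty open set \<open>U\<close> contains no periodic point of period \<open>> n\<close>, then \<open>f ^^ fact n\<close> fixes the
  periodic points in \<open>U\<close>, hence, by density and the Hausdorff property, all of \<open>U\<close>. Transitivity then
  forces the finite orbit of any \<open>x \<in> U\<close> to be the whole space: a point off this orbit could
  be separated from it, and all iterates of a small neighbourhood of \<open>x\<close> would stay on one side.
\<close>

lemma continuous_map_funpow:
  assumes "continuous_map X X f"
  shows "continuous_map X X (f ^^ n)"
proof (induction n)
  case 0
  then show ?case by (simp add: id_def)
next
  case (Suc n)
  then show ?case using continuous_map_compose[OF Suc assms] by (simp add: o_def)
qed

lemma funpow_eq_self_dvd:
  assumes "(f ^^ p) x = x" "p dvd m"
  shows "(f ^^ m) x = x"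
  using funpow_mod_eq[OF assms(1), of m, symmetric] assms(2) by (metis dvd_imp_mod_0 funpow_0)

lemma period_props:
  assumes "x \<in> periodic_points X f"
  shows "period f x > 0" "(f ^^ period f x) x = x"
proof -
  have "\<exists>n. n > 0 \<and> (f ^^ n) x = x"
    using assms by (auto simp: periodic_points_def)
  from LeastI_ex[OF this] show "period f x > 0" "(f ^^ period f x) x = x"
    by (auto simp: period_def)
qed

text \<open>Every positive integer up to \<open>n\<close> divides \<open>fact n\<close>, so this
  single exponent serves all these points at once, whatever their periods.\<close>

lemma funpow_fact_periodic_points_upto:
  assumes "x \<in> periodic_points_upto X f n"
  shows "(f ^^ fact n) x = x"
proof -
  have "x \<in> periodic_points X f" "period f x \<le> n"
    using assms by (auto simp: periodic_points_upto_def)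
  moreover from this(1) have "period f x > 0" "(f ^^ period f x) x = x"
    by (rule period_props)+
  ultimately show ?thesis
    using funpow_eq_self_dvd dvd_fact by (metis Suc_leI One_nat_def)
qed

lemma openin_subset_fixed_points_of_dense:
  assumes "Hausdorff_space X" "continuous_map X X g" "openin X U"
    and dense: "X closure_of P = topspace X"
    and fixed: "\<And>x. x \<in> U \<inter> P \<Longrightarrow> g x = x"
    and "x \<in> U"
  shows "g x = x"
proof -
  let ?C = "{z \<in> topspace X. g z = z}"
  \<comment> \<open>\<open>?C\<close> is the equalizer of \<open>g\<close> and the identity, which
    is closed because \<open>X\<close> is Hausdorff.\<close>
  have "closedin X ?C"
    using closedin_continuous_maps_eq[OF assms(1,2) continuous_map_id] by simp
  moreover have "U \<inter> P \<subseteq> ?C"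
    using fixed openin_subset[OF assms(3)] by auto
  ultimately have "X closure_of (U \<inter> P) \<subseteq> ?C"
    by (rule closure_of_minimal[rotated])
  \<comment> \<open>As \<open>U\<close> is open, a point of \<open>U\<close> in the closure of
    \<open>P\<close> already lies in the closure of \<open>U \<inter> P\<close>.\<close>
  moreover have "x \<in> U \<inter> X closure_of P"
    using assms(3,6) dense openin_subset by blast
  ultimately show ?thesis
    using openin_Int_closure_of_subset[OF assms(3)] by blast
qed

lemma transitive_imp_topspace_subset_finite_orbit:
  assumes haus: "Hausdorff_space X" and cont: "continuous_map X X f"
    and trans: "topologically_transitive X f"
    and U: "openin X U" "x \<in> U" and N: "N > 0"
    and fixed: "\<And>z. z \<in> U \<Longrightarrow> (f ^^ N) z = z"
  shows "topspace X \<subseteq> (\<lambda>i. (f ^^ i) x) ` {..<N}"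
proof
  fix y assume y: "y \<in> topspace X"
  let ?F = "(\<lambda>i. (f ^^ i) x) ` {..<N}"
  show "y \<in> ?F"
  proof (rule ccontr)
    assume "y \<notin> ?F"
    have x: "x \<in> topspace X"
      using U openin_subset by blast
    have "?F \<subseteq> topspace X"
      using x continuous_map_funpow[OF cont] by (auto simp: continuous_map_def)
    \<comment> \<open>Disjoint compact sets in a Hausdorff space have disjoint open
      neighbourhoods.\<close>
    then have "compactin X ?F" "compactin X {y}"
      using y by (simp_all add: finite_imp_compactin)
    then obtain A B where AB: "openin X A" "openin X B" "?F \<subseteq> A" "y \<in> B" "disjnt A B"
      using haus[unfolded Hausdorff_space_compact_sets, rule_format, of ?F "{y}"] \<open>y \<notin> ?F\<close>
      by (auto simp: disjnt_def)
    \<comment> \<open>The first \<open>N\<close> iterates, starting with the identity, send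
      \<open>V\<close> into \<open>A\<close>; finitely many conditions keep \<open>V\<close>
      open.\<close>
    define V where "V = U \<inter> ((\<Inter>i\<in>{..<N}. {z \<in> topspace X. (f ^^ i) z \<in> A}) \<inter> topspace X)"
    have "openin X {z \<in> topspace X. (f ^^ i) z \<in> A}" for i
      using openin_continuous_map_preimage[OF continuous_map_funpow[OF cont] AB(1)] .
    then have "openin X V"
      unfolding V_def by (intro openin_Int[OF U(1)] openin_INT) simp_all
    moreover have "x \<in> V"
      using U x AB(3) by (auto simp: V_def)
    ultimately obtain m where "(f ^^ m) ` V \<inter> B \<noteq> {}"
      using trans AB(2,4) unfolding topologically_transitive_def by blast
    then obtain z where z: "z \<in> V" "(f ^^ m) z \<in> B" by blast
    \<comment> \<open>Since \<open>f ^^ N\<close> fixes \<open>z\<close>, every iterate of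
      \<open>z\<close> equals one with exponent below \<open>N\<close>, so it stays in
      \<open>A\<close> and cannot enter \<open>B\<close>.\<close>
    have "(f ^^ (m mod N)) z = (f ^^ m) z"
      using z(1) by (intro funpow_mod_eq[OF fixed]) (simp add: V_def)
    moreover have "(f ^^ (m mod N)) z \<in> A"
      using z(1) N by (auto simp: V_def)
    ultimately show False
      using z(2) AB(5) by (auto simp: disjnt_iff)
  qed
qed

theorem mainTheorem1:
  fixes X :: "'a topology" and f :: "'a \<Rightarrow> 'a"
  assumes "infinite (topspace X)"
    and "Hausdorff_space X"
    and "continuous_map X X f"
    and "topologically_transitive X f"
    and "X closure_of (periodic_points X f) = topspace X"
  shows "DLP X f"
  unfolding DLP_def
proof (intro allI impI)
  fix n :: nat
  let ?Q = "periodic_points X f - periodic_points_upto X f n"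
  \<comment> \<open>The point \<open>x\<close> both witnesses that \<open>U\<close> is nonempty and
    supplies the finite orbit that would exhaust the space.\<close>
  have "U \<inter> ?Q \<noteq> {}" if U: "openin X U" "x \<in> U" for U x
  proof
    assume no_large: "U \<inter> ?Q = {}"
    have "(f ^^ fact n) z = z" if "z \<in> U" for z
    proof (rule openin_subset_fixed_points_of_dense
        [OF assms(2) continuous_map_funpow[OF assms(3)] U(1) assms(5) _ that])
      fix p assume "p \<in> U \<inter> periodic_points X f"
      with no_large have "p \<in> periodic_points_upto X f n" by blast
      then show "(f ^^ fact n) p = p" by (rule funpow_fact_periodic_points_upto)
    qed
    then have "topspace X \<subseteq> (\<lambda>i. (f ^^ i) x) ` {..<fact n}"
      by (intro transitive_imp_topspace_subset_finite_orbit[OF assms(2-4) U]) auto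
    with assms(1) show False
      using finite_surj[OF finite_lessThan] by blast
  qed
  then show "X closure_of ?Q = topspace X"
    unfolding dense_intersects_open by blast
qed

end
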